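(* Let $R$ be a ring, let $\mathcal C$ be a full subcategory of $\operatorname{Mod-}R$ all of whose objects are slender right $R$-modules, and let $\mathcal P$ be a completely prime ideal of $\mathcal C$. Let $\{A_i\mid i\in I\}$ and $\{B_j\mid j\in J\}$ be families of objects of $\mathcal C$ with $|I|$, $|J|$ non-measurable. Assume: (a) for every object $A$ of $\mathcal C$, $\mathcal P(A,A)$ is a maximal right ideal of $\operatorname{End}_R(A)$; (b) in each of the two families, each $\mathcal P$ class contains at most countably many members; (c) $\prod_{i\in I}A_i\cong\prod_{j\in J}B_j$. Then there is a bijection $\sigma\colon I\to J$ with $[A_i]_{\mathcal P}=[B_{\sigma(i)}]_{\mathcal P}$ for every $i\in I$.
   Context: A completely prime ideal $\mathcal P$ of a full subcategory $\mathcal C$ of $\operatorname{Mod-}R$ consists of a subgroup $\mathcal P(A,B)$ of $\operatorname{Hom}_R(A,B)$ for each pair of objects $A,B$ of $\mathcal C$ such that: (1) for all objects $A,B,C$ and morphisms $f\colon A\to B$, $g\colon B\to C$, one has $gf\in\mathcal P(A,C)$ if and only if $f\in\mathcal P(A,B)$ or $g\in\mathcal P(B,C)$; (2) $\mathcal P(A,A)\neq\operatorname{Hom}_R(A,A)$ for every object $A$. For objects $A,B$, write $[A]_{\mathcal P}=[B]_{\mathcal P}$ ("same $\mathcal P$ class") if $\mathcal P(A,B)\ne\operatorname{Hom}_R(A,B)$ and $\mathcal P(B,A)\neq\operatorname{Hom}_R(B,A)$. A right $R$-module $M$ is slender if for every homomorphism $f\colon R^\omega=\prod_{n<\omega}e_nR\to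 M$ (with $e_n$ the element having $1$ in position $n$ and $0$ elsewhere) there is $n_0$ with $f(e_n)=0$ for all $n\ge n_0$. *)

theory Defs
  imports Main "HOL-Library.FuncSet" "HOL-Library.Countable_Set"
begin

record ('r, 'm) rmod =
  mcarrier :: "'m set"
  madd :: "'m \<Rightarrow> 'm \<Rightarrow> 'm"
  mzero :: 'm
  mneg :: "'m \<Rightarrow> 'm"
  msmult :: "'m \<Rightarrow> 'r \<Rightarrow> 'm"

definition right_module :: "('r::ring_1, 'm) rmod \<Rightarrow> bool" where
  "right_module M \<longleftrightarrow>
     mzero M \<in> mcarrier M \<and>
     (\<forall>x\<in>mcarrier M. \<forall>y\<in>mcarrier M. madd M x y \<in> mcarrier M) \<and>
     (\<forall>x\<in>mcarrier M. mneg M x \<in> mcarrier M) \<and>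
     (\<forall>x\<in>mcarrier M. \<forall>r. msmult M x r \<in> mcarrier M) \<and>
     (\<forall>x\<in>mcarrier M. \<forall>y\<in>mcarrier M. \<forall>z\<in>mcarrier M.
        madd M (madd M x y) z = madd M x (madd M y z)) \<and>
     (\<forall>x\<in>mcarrier M. \<forall>y\<in>mcarrier M. madd M x y = madd M y x) \<and>
     (\<forall>x\<in>mcarrier M. madd M (mzero M) x = x) \<and>
     (\<forall>x\<in>mcarrier M. madd M (mneg M x) x = mzero M) \<and>
     (\<forall>x\<in>mcarrier M. \<forall>y\<in>mcarrier M. \<forall>r.
        msmult M (madd M x y) r = madd M (msmult M x r) (msmult M y r)) \<and>
     (\<forall>x\<in>mcarrier M. \<forall>r s.
        msmult M x (r + s) = madd M (msmult M x r) (msmult M x s)) \<and>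
     (\<forall>x\<in>mcarrier M. \<forall>r s. msmult M x (r * s) = msmult M (msmult M x r) s) \<and>
     (\<forall>x\<in>mcarrier M. msmult M x 1 = x)"

definition rhom :: "('r::ring_1, 'm) rmod \<Rightarrow> ('r, 'n) rmod \<Rightarrow> ('m \<Rightarrow> 'n) set" where
  "rhom M N = {f. f \<in> mcarrier M \<rightarrow>\<^sub>E mcarrier N \<and>
     (\<forall>x\<in>mcarrier M. \<forall>y\<in>mcarrier M. f (madd M x y) = madd N (f x) (f y)) \<and>
     (\<forall>x\<in>mcarrier M. \<forall>r. f (msmult M x r) = msmult N (f x) r)}"

definition hzero :: "('r, 'm) rmod \<Rightarrow> ('r, 'n) rmod \<Rightarrow> 'm \<Rightarrow> 'n" where
  "hzero M N = (\<lambda>x\<in>mcarrier M. mzero N)"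

definition hadd :: "('r, 'm) rmod \<Rightarrow> ('r, 'n) rmod \<Rightarrow> ('m \<Rightarrow> 'n) \<Rightarrow> ('m \<Rightarrow> 'n) \<Rightarrow> 'm \<Rightarrow> 'n" where
  "hadd M N f g = (\<lambda>x\<in>mcarrier M. madd N (f x) (g x))"

definition hneg :: "('r, 'm) rmod \<Rightarrow> ('r, 'n) rmod \<Rightarrow> ('m \<Rightarrow> 'n) \<Rightarrow> 'm \<Rightarrow> 'n" where
  "hneg M N f = (\<lambda>x\<in>mcarrier M. mneg N (f x))"

definition hom_subgroup :: "('r::ring_1, 'm) rmod \<Rightarrow> ('r, 'n) rmod \<Rightarrow> ('m \<Rightarrow> 'n) set \<Rightarrow> bool" where
  "hom_subgroup M N S \<longleftrightarrow> S \<subseteq> rhom M N \<and> hzero M N \<in> S \<and>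
     (\<forall>f\<in>S. \<forall>g\<in>S. hadd M N f g \<in> S) \<and> (\<forall>f\<in>S. hneg M N f \<in> S)"

text \<open>A full subcategory is given by its class of objects C; morphisms are all R-homomorphisms.
  Composition gf (first f then g) is compose (mcarrier A) g f.\<close>
definition completely_prime_ideal ::
  "('r::ring_1, 'm) rmod set \<Rightarrow> (('r, 'm) rmod \<Rightarrow> ('r, 'm) rmod \<Rightarrow> ('m \<Rightarrow> 'm) set) \<Rightarrow> bool" where
  "completely_prime_ideal C P \<longleftrightarrow>
     (\<forall>A\<in>C. \<forall>B\<in>C. hom_subgroup A B (P A B)) \<and>
     (\<forall>A\<in>C. \<forall>B\<in>C. \<forall>D\<in>C. \<forall>f\<in>rhom A B. \<forall>g\<in>rhom B D.
        (compose (mcarrier A) g f \<in> P A D \<longleftrightarrow> f \<in> P A B \<or> g \<in> P B D)) \<and>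
     (\<forall>A\<in>C. P A A \<noteq> rhom A A)"

definition same_class ::
  "(('r::ring_1, 'm) rmod \<Rightarrow> ('r, 'm) rmod \<Rightarrow> ('m \<Rightarrow> 'm) set) \<Rightarrow> ('r, 'm) rmod \<Rightarrow> ('r, 'm) rmod \<Rightarrow> bool" where
  "same_class P A B \<longleftrightarrow> P A B \<noteq> rhom A B \<and> P B A \<noteq> rhom B A"

definition end_right_ideal :: "('r::ring_1, 'm) rmod \<Rightarrow> ('m \<Rightarrow> 'm) set \<Rightarrow> bool" where
  "end_right_ideal A S \<longleftrightarrow> hom_subgroup A A S \<and>
     (\<forall>f\<in>S. \<forall>h\<in>rhom A A. compose (mcarrier A) f h \<in> S)"

definition end_maximal_right_ideal :: "('r::ring_1, 'm) rmod \<Rightarrow> ('m \<Rightarrow> 'm) set \<Rightarrow> bool" where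
  "end_maximal_right_ideal A S \<longleftrightarrow> end_right_ideal A S \<and> S \<noteq> rhom A A \<and>
     (\<forall>T. end_right_ideal A T \<and> S \<subseteq> T \<longrightarrow> T = S \<or> T = rhom A A)"

definition Romega :: "('r::ring_1, nat \<Rightarrow> 'r) rmod" where
  "Romega = \<lparr>mcarrier = UNIV, madd = (\<lambda>x y n. x n + y n), mzero = (\<lambda>n. 0),
     mneg = (\<lambda>x n. - x n), msmult = (\<lambda>x r n. x n * r)\<rparr>"

definition unit_vec :: "nat \<Rightarrow> nat \<Rightarrow> 'r::ring_1" where
  "unit_vec n = (\<lambda>k. if k = n then 1 else 0)"

definition slender :: "('r::ring_1, 'm) rmod \<Rightarrow> bool" where
  "slender M \<longleftrightarrow> (\<forall>f\<in>rhom (Romega :: ('r, nat \<Rightarrow> 'r) rmod) M.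
      \<exists>n0. \<forall>n\<ge>n0. f (unit_vec n) = mzero M)"

definition rprod :: "'i set \<Rightarrow> ('i \<Rightarrow> ('r, 'm) rmod) \<Rightarrow> ('r, 'i \<Rightarrow> 'm) rmod" where
  "rprod I A = \<lparr>mcarrier = (\<Pi>\<^sub>E i\<in>I. mcarrier (A i)),
     madd = (\<lambda>x y. \<lambda>i\<in>I. madd (A i) (x i) (y i)),
     mzero = (\<lambda>i\<in>I. mzero (A i)),
     mneg = (\<lambda>x. \<lambda>i\<in>I. mneg (A i) (x i)),
     msmult = (\<lambda>x r. \<lambda>i\<in>I. msmult (A i) (x i) r)\<rparr>"

definition rmod_iso :: "('r::ring_1, 'm) rmod \<Rightarrow> ('r, 'n) rmod \<Rightarrow> bool" where
  "rmod_iso M N \<longleftrightarrow> (\<exists>f. f \<in> rhom M N \<and> bij_betw f (mcarrier M) (mcarrier N))"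

text \<open>|I| is (Ulam-)measurable iff I carries a non-principal countably complete ultrafilter.\<close>
definition measurable_card :: "'i set \<Rightarrow> bool" where
  "measurable_card I \<longleftrightarrow> (\<exists>U :: 'i set set. U \<subseteq> Pow I \<and> I \<in> U \<and> {} \<notin> U \<and>
     (\<forall>X\<in>U. \<forall>Y. X \<subseteq> Y \<and> Y \<subseteq> I \<longrightarrow> Y \<in> U) \<and>
     (\<forall>X. X \<subseteq> I \<longrightarrow> X \<in> U \<or> I - X \<in> U) \<and>
     (\<forall>F :: nat \<Rightarrow> 'i set. (\<forall>n. F n \<in> U) \<longrightarrow> (\<Inter>n. F n) \<in> U) \<and>
     (\<forall>x\<in>I. {x} \<notin> U))"

end

theory Submission
  imports Defs
begin

text \<open>
  A homomorphism from a product over a non-measurable index set to a slender module factors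
  through finitely many factors. Hence, for mutually inverse \<open>\<alpha>\<close> and \<open>\<beta>\<close> between the two products,
  each component of \<open>\<beta>\<alpha>\<close> is a finite sum of composites through the \<open>B j\<close>, and modulo P only
  the \<open>B j\<close> in the class at hand contribute. Since \<open>P(M,M)\<close> is a maximal right ideal and
  completely prime, a morphism outside P between two objects of the same class is invertible
  modulo P, so Gaussian elimination works within a class: n factors \<open>A i\<close> cannot be recovered
  from fewer than n factors \<open>B j\<close>. By symmetry and countability each class occurs equally often in
  both families.
\<close>

section \<open>Modules and homomorphisms\<close>

lemma right_module_closed:
  assumes "right_module M"
  shows "mzero M \<in> mcarrier M"
    and "\<And>x y. x \<in> mcarrier M \<Longrightarrow> y \<in> mcarrier M \<Longrightarrow> madd M x y \<in> mcarrier M"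
    and "\<And>x. x \<in> mcarrier M \<Longrightarrow> mneg M x \<in> mcarrier M"
    and "\<And>x r. x \<in> mcarrier M \<Longrightarrow> msmult M x r \<in> mcarrier M"
  using assms unfolding right_module_def by auto

lemma right_module_add:
  assumes "right_module M"
  shows "\<And>x y z. x \<in> mcarrier M \<Longrightarrow> y \<in> mcarrier M \<Longrightarrow> z \<in> mcarrier M \<Longrightarrow>
           madd M (madd M x y) z = madd M x (madd M y z)"
    and "\<And>x y. x \<in> mcarrier M \<Longrightarrow> y \<in> mcarrier M \<Longrightarrow> madd M x y = madd M y x"
    and "\<And>x. x \<in> mcarrier M \<Longrightarrow> madd M (mzero M) x = x"
    and "\<And>x. x \<in> mcarrier M \<Longrightarrow> madd M (mneg M x) x = mzero M"
  using assms unfolding right_module_def by blast+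

lemma right_module_smult:
  assumes "right_module M"
  shows "\<And>x y r. x \<in> mcarrier M \<Longrightarrow> y \<in> mcarrier M \<Longrightarrow>
           msmult M (madd M x y) r = madd M (msmult M x r) (msmult M y r)"
    and "\<And>x r s. x \<in> mcarrier M \<Longrightarrow> msmult M x (r + s) = madd M (msmult M x r) (msmult M x s)"
    and "\<And>x r s. x \<in> mcarrier M \<Longrightarrow> msmult M x (r * s) = msmult M (msmult M x r) s"
    and "\<And>x. x \<in> mcarrier M \<Longrightarrow> msmult M x 1 = x"
  using assms unfolding right_module_def by blast+

lemma madd_zero_right:
  assumes "right_module M" "x \<in> mcarrier M"
  shows "madd M x (mzero M) = x"
  using assms by (metis right_module_add(2,3) right_module_closed(1))

lemma madd_neg_right:
  assumes "right_module M" "x \<in> mcarrier M"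
  shows "madd M x (mneg M x) = mzero M"
  using assms by (metis right_module_add(2,4) right_module_closed(3))

lemma madd_left_commute:
  assumes "right_module M" "x \<in> mcarrier M" "y \<in> mcarrier M" "z \<in> mcarrier M"
  shows "madd M x (madd M y z) = madd M y (madd M x z)"
  using assms by (metis right_module_add(1,2))

lemma madd_left_cancel:
  assumes M: "right_module M" and x: "x \<in> mcarrier M"
    and y: "y \<in> mcarrier M" and z: "z \<in> mcarrier M"
    and eq: "madd M x y = madd M x z"
  shows "y = z"
proof -
  have "madd M (madd M (mneg M x) x) y = madd M (madd M (mneg M x) x) z"
    using right_module_add(1)[OF M] right_module_closed(3)[OF M] x y z eq by simp
  then show ?thesis
    using right_module_add(3,4)[OF M] x y z by simp
qed

lemma madd_self_zero:
  assumes "right_module M" "x \<in> mcarrier M" "madd M x x = x"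
  shows "x = mzero M"
  using assms madd_left_cancel[of M x x "mzero M"]
  by (simp add: madd_zero_right right_module_closed)

lemma msmult_zero:
  assumes M: "right_module M" and x: "x \<in> mcarrier M"
  shows "msmult M x 0 = mzero M"
  using madd_self_zero[OF M right_module_closed(4)[OF M x, of 0]]
    right_module_smult(2)[OF M x, of 0 0] by simp

lemma mzero_smult:
  assumes M: "right_module M"
  shows "msmult M (mzero M) r = mzero M"
  using madd_self_zero[OF M right_module_closed(4)[OF M right_module_closed(1)[OF M], of r]]
    right_module_smult(1)[OF M right_module_closed(1)[OF M] right_module_closed(1)[OF M], of r]
    right_module_add(3)[OF M right_module_closed(1)[OF M]]
  by simp

lemma mneg_unique:
  assumes M: "right_module M" and x: "x \<in> mcarrier M" and y: "y \<in> mcarrier M"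
    and eq: "madd M x y = mzero M"
  shows "y = mneg M x"
  using madd_left_cancel[OF M x y right_module_closed(3)[OF M x]] madd_neg_right[OF M x] eq
  by simp

lemma mneg_add:
  assumes M: "right_module M" and x: "x \<in> mcarrier M" and y: "y \<in> mcarrier M"
  shows "mneg M (madd M x y) = madd M (mneg M x) (mneg M y)"
proof (rule mneg_unique[OF M, symmetric])
  have "madd M (madd M x y) (madd M (mneg M x) (mneg M y))
      = madd M x (madd M (mneg M x) (madd M y (mneg M y)))"
    using x y by (simp add: right_module_add(1)[OF M] right_module_closed[OF M]
        madd_left_commute[OF M, of y "mneg M x" "mneg M y"])
  then show "madd M (madd M x y) (madd M (mneg M x) (mneg M y)) = mzero M"
    using x y by (simp add: madd_neg_right[OF M] madd_zero_right[OF M] right_module_closed[OF M])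
qed (use x y in \<open>simp_all add: right_module_closed[OF M]\<close>)

lemma mneg_smult:
  assumes M: "right_module M" and x: "x \<in> mcarrier M"
  shows "mneg M (msmult M x r) = msmult M (mneg M x) r"
proof (rule mneg_unique[OF M, symmetric])
  show "madd M (msmult M x r) (msmult M (mneg M x) r) = mzero M"
    using right_module_smult(1)[OF M x right_module_closed(3)[OF M x], of r]
      madd_neg_right[OF M x] mzero_smult[OF M, of r] by simp
qed (use x in \<open>simp_all add: right_module_closed[OF M]\<close>)

text \<open>Unlike membership in the set of homomorphisms, this predicate ignores the values outside
  the carrier, so that homomorphisms can be composed as plain functions.\<close>
definition is_rhom :: "('r::ring_1, 'm) rmod \<Rightarrow> ('r, 'n) rmod \<Rightarrow> ('m \<Rightarrow> 'n) \<Rightarrow> bool" where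
  "is_rhom M N f \<longleftrightarrow> f \<in> mcarrier M \<rightarrow> mcarrier N \<and>
     (\<forall>x\<in>mcarrier M. \<forall>y\<in>mcarrier M. f (madd M x y) = madd N (f x) (f y)) \<and>
     (\<forall>x\<in>mcarrier M. \<forall>r. f (msmult M x r) = msmult N (f x) r)"

lemma is_rhomI:
  assumes "\<And>x. x \<in> mcarrier M \<Longrightarrow> f x \<in> mcarrier N"
    and "\<And>x y. x \<in> mcarrier M \<Longrightarrow> y \<in> mcarrier M \<Longrightarrow> f (madd M x y) = madd N (f x) (f y)"
    and "\<And>x r. x \<in> mcarrier M \<Longrightarrow> f (msmult M x r) = msmult N (f x) r"
  shows "is_rhom M N f"
  using assms unfolding is_rhom_def by auto

lemma is_rhomD:
  assumes "is_rhom M N f"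
  shows "\<And>x. x \<in> mcarrier M \<Longrightarrow> f x \<in> mcarrier N"
    and "\<And>x y. x \<in> mcarrier M \<Longrightarrow> y \<in> mcarrier M \<Longrightarrow> f (madd M x y) = madd N (f x) (f y)"
    and "\<And>x r. x \<in> mcarrier M \<Longrightarrow> f (msmult M x r) = msmult N (f x) r"
  using assms unfolding is_rhom_def by auto

lemma rhom_is_rhom: "f \<in> rhom M N \<Longrightarrow> is_rhom M N f"
  unfolding rhom_def is_rhom_def by (auto simp: PiE_iff)

text \<open>The carrier is closed under the operations, so sums and multiples are evaluated where
  the restriction agrees with \<open>f\<close>. This translates between \<open>rhom\<close> and
  \<open>is_rhom\<close>.\<close>

lemma restrict_in_rhom_iff:
  assumes "right_module M"
  shows "restrict f (mcarrier M) \<in> rhom M N \<longleftrightarrow> is_rhom M N f"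
  using right_module_closed[OF assms]
  unfolding rhom_def is_rhom_def by (auto simp: PiE_iff Pi_iff)

lemma rhom_restrict: "f \<in> rhom M N \<Longrightarrow> restrict f (mcarrier M) = f"
  unfolding rhom_def by (auto simp: PiE_restrict)

lemma is_rhom_zero_neg:
  assumes M: "right_module M" and N: "right_module N" and f: "is_rhom M N f"
  shows "f (mzero M) = mzero N"
    and "\<And>x. x \<in> mcarrier M \<Longrightarrow> f (mneg M x) = mneg N (f x)"
proof -
  show zero: "f (mzero M) = mzero N"
    using madd_self_zero[OF N, of "f (mzero M)"] is_rhomD(1,2)[OF f] right_module_closed(1)[OF M]
      right_module_add(3)[OF M] by metis
  show "f (mneg M x) = mneg N (f x)" if x: "x \<in> mcarrier M" for x
  proof (rule mneg_unique[OF N])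
    show "madd N (f x) (f (mneg M x)) = mzero N"
      using is_rhomD(2)[OF f x right_module_closed(3)[OF M x]] zero madd_neg_right[OF M x] by simp
  qed (use x in \<open>simp_all add: is_rhomD(1)[OF f] right_module_closed[OF M]\<close>)
qed

lemma is_rhom_comp:
  assumes "is_rhom M N f" "is_rhom N K g"
  shows "is_rhom M K (\<lambda>x. g (f x))"
  using assms unfolding is_rhom_def by (auto simp: Pi_iff)

lemma is_rhom_id: "is_rhom M M (\<lambda>x. x)"
  by (auto intro: is_rhomI)

lemma is_rhom_zero:
  assumes "right_module N"
  shows "is_rhom M N (\<lambda>_. mzero N)"
  using right_module_closed(1)[OF assms] right_module_add(3)[OF assms] mzero_smult[OF assms]
  by (auto intro!: is_rhomI)

lemma is_rhom_neg:
  assumes N: "right_module N" and f: "is_rhom M N f"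
  shows "is_rhom M N (\<lambda>x. mneg N (f x))"
  using is_rhomD[OF f] mneg_add[OF N] mneg_smult[OF N] right_module_closed[OF N]
  by (auto intro!: is_rhomI)

lemma is_rhom_add:
  assumes N: "right_module N" and f: "is_rhom M N f" and g: "is_rhom M N g"
  shows "is_rhom M N (\<lambda>x. madd N (f x) (g x))"
proof (rule is_rhomI)
  fix x y assume x: "x \<in> mcarrier M" and y: "y \<in> mcarrier M"
  note [simp] = is_rhomD(1)[OF f x] is_rhomD(1)[OF f y] is_rhomD(1)[OF g x] is_rhomD(1)[OF g y]
  show "madd N (f (madd M x y)) (g (madd M x y)) =
      madd N (madd N (f x) (g x)) (madd N (f y) (g y))"
    using x y by (simp add: is_rhomD(2)[OF f] is_rhomD(2)[OF g] right_module_add(1)[OF N]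
        madd_left_commute[OF N, of "f y" "g x" "g y"] right_module_closed[OF N])
qed (use is_rhomD[OF f] is_rhomD[OF g] right_module_smult(1)[OF N] right_module_closed[OF N]
      in auto)

section \<open>Products\<close>

lemma rprod_simps:
  "mcarrier (rprod I A) = (\<Pi>\<^sub>E i\<in>I. mcarrier (A i))"
  "madd (rprod I A) x y = (\<lambda>i\<in>I. madd (A i) (x i) (y i))"
  "mzero (rprod I A) = (\<lambda>i\<in>I. mzero (A i))"
  "mneg (rprod I A) x = (\<lambda>i\<in>I. mneg (A i) (x i))"
  "msmult (rprod I A) x r = (\<lambda>i\<in>I. msmult (A i) (x i) r)"
  by (simp_all add: rprod_def)

lemma rprod_mem: "x \<in> mcarrier (rprod I A) \<Longrightarrow> i \<in> I \<Longrightarrow> x i \<in> mcarrier (A i)"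
  by (auto simp: rprod_simps)

lemma rprod_eqI:
  assumes "x \<in> mcarrier (rprod I A)" "y \<in> mcarrier (rprod I A)" "\<And>i. i \<in> I \<Longrightarrow> x i = y i"
  shows "x = y"
  using assms by (auto simp: rprod_simps intro: PiE_ext)

lemma right_module_rprod:
  assumes "\<And>i. i \<in> I \<Longrightarrow> right_module (A i)"
  shows "right_module (rprod I A)"
  unfolding right_module_def
proof (intro conjI ballI allI)
  note mem = rprod_mem[of _ I A]
  note closed = right_module_closed[OF assms]
  show zero: "mzero (rprod I A) \<in> mcarrier (rprod I A)"
    by (auto simp: rprod_simps closed)
  fix x assume x: "x \<in> mcarrier (rprod I A)"
  note xi = mem[OF x]
  show "mneg (rprod I A) x \<in> mcarrier (rprod I A)"
    using xi by (auto simp: rprod_simps closed)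
  show smult: "msmult (rprod I A) x r \<in> mcarrier (rprod I A)" for r
    using xi by (auto simp: rprod_simps closed)
  show "madd (rprod I A) (mzero (rprod I A)) x = x"
  proof (rule rprod_eqI[OF _ x])
    show "madd (rprod I A) (mzero (rprod I A)) x \<in> mcarrier (rprod I A)"
      using xi by (auto simp: rprod_simps closed)
  qed (use xi in \<open>simp add: rprod_simps right_module_add(3)[OF assms]\<close>)
  show "madd (rprod I A) (mneg (rprod I A) x) x = mzero (rprod I A)"
    using xi by (auto simp: rprod_simps right_module_add(4)[OF assms] intro!: restrict_ext)
  show "msmult (rprod I A) x (r + s) = madd (rprod I A) (msmult (rprod I A) x r) (msmult (rprod I A) x s)"
    "msmult (rprod I A) x (r * s) = msmult (rprod I A) (msmult (rprod I A) x r) s" for r s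
    using xi by (auto simp: rprod_simps right_module_smult(2,3)[OF assms] intro!: restrict_ext)
  show "msmult (rprod I A) x 1 = x"
    by (rule rprod_eqI[OF smult x])
      (use xi in \<open>simp add: rprod_simps right_module_smult(4)[OF assms]\<close>)
  fix y assume y: "y \<in> mcarrier (rprod I A)"
  note yi = mem[OF y]
  show "madd (rprod I A) x y \<in> mcarrier (rprod I A)"
    using xi yi by (auto simp: rprod_simps closed)
  show "madd (rprod I A) x y = madd (rprod I A) y x"
    unfolding rprod_simps by (intro restrict_ext right_module_add(2)[OF assms] xi yi)
  show "msmult (rprod I A) (madd (rprod I A) x y) r =
      madd (rprod I A) (msmult (rprod I A) x r) (msmult (rprod I A) y r)" for r
    using xi yi by (auto simp: rprod_simps right_module_smult(1)[OF assms] intro!: restrict_ext)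
  fix z assume z: "z \<in> mcarrier (rprod I A)"
  show "madd (rprod I A) (madd (rprod I A) x y) z = madd (rprod I A) x (madd (rprod I A) y z)"
    using xi yi mem[OF z] by (auto simp: rprod_simps right_module_add(1)[OF assms] intro!: restrict_ext)
qed

lemma is_rhom_proj: "i \<in> I \<Longrightarrow> is_rhom (rprod I A) (A i) (\<lambda>x. x i)"
  by (auto intro!: is_rhomI simp: rprod_simps)

section \<open>Cutting vectors down to a set of coordinates\<close>

text \<open>Projection onto the factors in \<open>S\<close> followed by their inclusion. Staying
  inside the full product lets one homomorphism be applied to all pieces of a vector.\<close>

definition prod_cut :: "'i set \<Rightarrow> ('i \<Rightarrow> ('r, 'm) rmod) \<Rightarrow> 'i set \<Rightarrow> ('i \<Rightarrow> 'm) \<Rightarrow> 'i \<Rightarrow> 'm" where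
  "prod_cut I A S x = (\<lambda>i\<in>I. if i \<in> S then x i else mzero (A i))"

definition single :: "'i set \<Rightarrow> ('i \<Rightarrow> ('r, 'm) rmod) \<Rightarrow> 'i \<Rightarrow> 'm \<Rightarrow> 'i \<Rightarrow> 'm" where
  "single I A j y = (\<lambda>i\<in>I. if i = j then y else mzero (A i))"

lemma prod_cut_singleton: "prod_cut I A {j} x = single I A j (x j)"
  by (auto simp: prod_cut_def single_def)

lemma prod_cut_closed:
  assumes "\<And>i. i \<in> I \<Longrightarrow> right_module (A i)" "x \<in> mcarrier (rprod I A)"
  shows "prod_cut I A S x \<in> mcarrier (rprod I A)"
  using assms by (auto simp: prod_cut_def rprod_simps right_module_closed)

lemma is_rhom_single:
  assumes "\<And>i. i \<in> I \<Longrightarrow> right_module (A i)" "j \<in> I"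
  shows "is_rhom (A j) (rprod I A) (single I A j)"
proof (rule is_rhomI)
  show "single I A j x \<in> mcarrier (rprod I A)" if "x \<in> mcarrier (A j)" for x
    using assms that by (auto simp: single_def rprod_simps right_module_closed)
  show "single I A j (madd (A j) x y) = madd (rprod I A) (single I A j x) (single I A j y)" for x y
    using assms by (auto simp: single_def rprod_simps right_module_add(3) right_module_closed)
  show "single I A j (msmult (A j) x r) = msmult (rprod I A) (single I A j x) r" for x r
    using assms by (auto simp: single_def rprod_simps mzero_smult)
qed

text \<open>At each coordinate one of the two pieces is zero and the other equals the left-hand
  side.\<close>

lemma prod_cut_split:
  assumes A: "\<And>i. i \<in> I \<Longrightarrow> right_module (A i)" and x: "x \<in> mcarrier (rprod I A)"
  shows "prod_cut I A S x = madd (rprod I A) (prod_cut I A (S \<inter> T) x) (prod_cut I A (S - T) x)"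
proof (rule rprod_eqI[of _ I A])
  fix i assume "i \<in> I"
  then show "prod_cut I A S x i = madd (rprod I A) (prod_cut I A (S \<inter> T) x) (prod_cut I A (S - T) x) i"
    using A[of i] rprod_mem[OF x, of i]
    by (auto simp: prod_cut_def rprod_simps right_module_add(3) madd_zero_right right_module_closed)
qed (use assms in \<open>simp_all add: prod_cut_closed right_module_closed right_module_rprod\<close>)

lemma is_rhom_prod_cut_split:
  assumes A: "\<And>i. i \<in> I \<Longrightarrow> right_module (A i)" and x: "x \<in> mcarrier (rprod I A)"
    and f: "is_rhom (rprod I A) M f"
  shows "f (prod_cut I A S x) = madd M (f (prod_cut I A (S \<inter> T) x)) (f (prod_cut I A (S - T) x))"
  using prod_cut_split[OF A x, of S T] is_rhomD(2)[OF f] prod_cut_closed[OF A x] by metis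

lemma prod_cut_all: "x \<in> mcarrier (rprod I A) \<Longrightarrow> prod_cut I A I x = x"
  by (auto simp: prod_cut_def rprod_simps PiE_iff extensional_def)

lemma prod_cut_empty: "prod_cut I A {} x = mzero (rprod I A)"
  by (simp add: prod_cut_def rprod_simps)

lemma prod_cut_cut: "prod_cut I A S (prod_cut I A T x) = prod_cut I A (S \<inter> T) x"
  by (auto simp: prod_cut_def)

section \<open>Homomorphisms from products to slender modules\<close>

text \<open>Point-finiteness of the family S makes the sum of the multiples of the restrictions of a
  to S n a well-defined homomorphism from the countable power of the ring to the product.\<close>
lemma slender_point_finite:
  fixes A :: "'i \<Rightarrow> ('r::ring_1, 'm) rmod" and M :: "('r, 'n) rmod" and S :: "nat \<Rightarrow> 'i set"
  assumes A: "\<And>i. i \<in> I \<Longrightarrow> right_module (A i)"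
    and "slender M" and f: "is_rhom (rprod I A) M f"
    and a: "a \<in> mcarrier (rprod I A)" and fin: "\<And>i. i \<in> I \<Longrightarrow> finite {n. i \<in> S n}"
  shows "\<exists>n0. \<forall>n\<ge>n0. f (prod_cut I A (S n) a) = mzero M"
proof -
  define \<phi> where "\<phi> = (\<lambda>y :: nat \<Rightarrow> 'r. \<lambda>i\<in>I. msmult (A i) (a i) (\<Sum>n | i \<in> S n. y n))"
  have "is_rhom Romega (rprod I A) \<phi>"
  proof (rule is_rhomI)
    show "\<phi> y \<in> mcarrier (rprod I A)" for y
      using A rprod_mem[OF a] by (auto simp: \<phi>_def rprod_simps right_module_closed)
    show "\<phi> (madd Romega y z) = madd (rprod I A) (\<phi> y) (\<phi> z)" for y z
      using A rprod_mem[OF a]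
      by (auto simp: \<phi>_def rprod_simps Romega_def sum.distrib right_module_smult intro!: restrict_ext)
    show "\<phi> (msmult Romega y r) = msmult (rprod I A) (\<phi> y) r" for y r
      using A rprod_mem[OF a]
      by (auto simp: \<phi>_def rprod_simps Romega_def sum_distrib_right[symmetric] right_module_smult
          intro!: restrict_ext)
  qed
  then have "is_rhom Romega M (\<lambda>y. f (\<phi> y))"
    using f by (rule is_rhom_comp)
  \<comment> \<open>The carrier of \<open>Romega\<close> is the whole type, so the extensionality
    demanded by \<open>rhom\<close> is automatic.\<close>
  then have "(\<lambda>y. f (\<phi> y)) \<in> rhom Romega M"
    by (auto simp: is_rhom_def rhom_def Romega_def)
  then obtain n0 where n0: "\<forall>n\<ge>n0. f (\<phi> (unit_vec n)) = mzero M"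
    using bspec[OF \<open>slender M\<close>[unfolded slender_def]] by fast
  \<comment> \<open>On the \<open>n\<close>-th unit vector only the summand \<open>n\<close>
    survives, so the coefficient of \<open>a i\<close> is 1 or 0 according to whether
    \<open>i \<in> S n\<close>.\<close>
  have "\<phi> (unit_vec n) = prod_cut I A (S n) a" for n
  proof -
    have "(\<Sum>k | i \<in> S k. unit_vec n k) = (if i \<in> S n then 1 else 0 :: 'r)" if "i \<in> I" for i
      using fin[OF that] by (simp add: unit_vec_def)
    then show ?thesis
      using A rprod_mem[OF a]
      by (auto simp: \<phi>_def prod_cut_def right_module_smult msmult_zero intro!: restrict_ext)
  qed
  with n0 show ?thesis by auto
qed

text \<open>The subsets of I on which f vanishes hereditarily along a form a \<open>\<sigma>\<close>-ideal, and
  slenderness excludes infinitely many disjoint sets outside it. If f a were nonzero, some set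
  would therefore be an atom of the quotient, and an atom is a countably complete ultrafilter.\<close>
lemma slender_vanish:
  fixes A :: "'i \<Rightarrow> ('r::ring_1, 'm) rmod" and M :: "('r, 'n) rmod"
  assumes A: "\<And>i. i \<in> I \<Longrightarrow> right_module (A i)" and M: "right_module M"
    and "slender M" and f: "is_rhom (rprod I A) M f"
    and nonmeas: "\<not> measurable_card I"
    and a: "a \<in> mcarrier (rprod I A)"
    and single: "\<And>i. i \<in> I \<Longrightarrow> f (prod_cut I A {i} a) = mzero M"
  shows "f a = mzero M"
proof (rule ccontr)
  assume nonzero: "f a \<noteq> mzero M"
  \<comment> \<open>Vanishing is required on all subsets because nonzero contributions of parts of
    \<open>X\<close> may cancel in \<open>f (prod_cut I A X a)\<close>.\<close>
  define null where "null = (\<lambda>X. \<forall>Y\<subseteq>X. f (prod_cut I A Y a) = mzero M)"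
  note point_finite = slender_point_finite[OF A \<open>slender M\<close> f a]
  have closed: "f (prod_cut I A Y a) \<in> mcarrier M" for Y
    using is_rhomD(1)[OF f] prod_cut_closed[OF A a] by blast
  have split: "f (prod_cut I A Y a) = madd M (f (prod_cut I A (Y \<inter> Z) a)) (f (prod_cut I A (Y - Z) a))" for Y Z
    by (rule is_rhom_prod_cut_split[OF A a f])
  have null_mono: "null Y" if "null X" "Y \<subseteq> X" for X Y
    using that unfolding null_def by blast
  have null_empty: "null {}"
    using is_rhom_zero_neg(1)[OF right_module_rprod[OF A] M f] by (simp add: null_def prod_cut_empty)
  have null_Un: "null (X \<union> Y)" if "null X" "null Y" for X Y
    unfolding null_def
  proof (intro allI impI)
    fix Z assume "Z \<subseteq> X \<union> Y"
    then have "f (prod_cut I A (Z \<inter> X) a) = mzero M" "f (prod_cut I A (Z - X) a) = mzero M"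
      using that unfolding null_def by blast+
    then show "f (prod_cut I A Z a) = mzero M"
      using split[of Z X] right_module_add(3)[OF M] right_module_closed(1)[OF M] by simp
  qed
  have null_UN: "null (\<Union>n. X n)" if X: "\<And>n::nat. null (X n)" for X
    unfolding null_def
  proof (intro allI impI)
    fix Y assume Y: "Y \<subseteq> (\<Union>n. X n)"
    \<comment> \<open>Removing \<open>X 0\<close>, \<open>X 1\<close>, ... from \<open>Y\<close> one
      by one never changes the value of \<open>f\<close>, since each removed piece is null. Every
      point of \<open>Y\<close> is eventually removed, so the remainders are point-finite and some
      remainder has value zero.\<close>
    define T where "T = (\<lambda>n. Y - (\<Union>k<n. X k))"
    have "finite {n. i \<in> T n}" for i
    proof (cases "i \<in> Y")
      case True
      then obtain k where "i \<in> X k" using Y by blast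
      then have "{n. i \<in> T n} \<subseteq> {..k}" by (auto simp: T_def not_less[symmetric])
      then show ?thesis using finite_subset by blast
    qed (simp add: T_def)
    then obtain n where n: "f (prod_cut I A (T n) a) = mzero M"
      using point_finite[of T] by blast
    have "f (prod_cut I A (T n) a) = f (prod_cut I A Y a)" for n
    proof (induction n)
      case (Suc n)
      have eq: "T (Suc n) = T n - X n" by (auto simp: T_def lessThan_Suc)
      have "f (prod_cut I A (T n \<inter> X n) a) = mzero M" using X unfolding null_def by blast
      then have "f (prod_cut I A (T n) a) = f (prod_cut I A (T (Suc n)) a)"
        unfolding eq using split[of "T n" "X n"] right_module_add(3)[OF M] closed by simp
      with Suc show ?case by simp
    qed (simp add: T_def)
    with n show "f (prod_cut I A Y a) = mzero M" by simp
  qed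
  have not_null_I: "\<not> null I"
    using nonzero prod_cut_all[OF a] unfolding null_def by (metis order_refl)
  \<comment> \<open>Without an atom, every non-null set splits into two non-null parts. Iterating
    the choice \<open>s\<close> of one part gives a decreasing sequence whose successive differences
    are non-null.\<close>
  have "\<exists>X\<subseteq>I. \<not> null X \<and> (\<forall>Y\<subseteq>X. null Y \<or> null (X - Y))"
  proof (rule ccontr)
    assume "\<not> ?thesis"
    then have "\<exists>Y\<subseteq>X. \<not> null Y \<and> \<not> null (X - Y)" if "X \<subseteq> I" "\<not> null X" for X
      using that by blast
    then obtain s where s: "\<And>X. X \<subseteq> I \<Longrightarrow> \<not> null X \<Longrightarrow> s X \<subseteq> X \<and> \<not> null (s X) \<and> \<not> null (X - s X)"
      by metis
    define X where "X = (\<lambda>n. (s ^^ n) I)"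
    have X: "X n \<subseteq> I \<and> \<not> null (X n)" for n
    proof (induction n)
      case (Suc n)
      then show ?case using s[of "X n"] by (auto simp: X_def)
    qed (simp add: X_def not_null_I)
    have X_Suc: "X (Suc n) = s (X n)" for n by (simp add: X_def)
    have X_anti: "X n \<subseteq> X m" if "m \<le> n" for m n
      using that by (rule lift_Suc_antimono_le[rotated]) (use X s X_Suc in auto)
    \<comment> \<open>The differences are pairwise disjoint, so the sets \<open>Z n\<close> picked
      inside them are point-finite, although \<open>f\<close> is nonzero on every cut to
      \<open>Z n\<close>.\<close>
    have "\<exists>Z\<subseteq>X n - X (Suc n). f (prod_cut I A Z a) \<noteq> mzero M" for n
      using X[of n] s[of "X n"] X_Suc[of n] unfolding null_def by metis
    then obtain Z where Z: "\<And>n. Z n \<subseteq> X n - X (Suc n)" "\<And>n. f (prod_cut I A (Z n) a) \<noteq> mzero M"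
      by metis
    have "finite {n. i \<in> Z n}" for i
    proof -
      have "m = n" if "i \<in> Z m" "i \<in> Z n" for m n
      proof (rule ccontr)
        assume "m \<noteq> n"
        then have "Suc m \<le> n \<or> Suc n \<le> m" by linarith
        then show False using X_anti[of "Suc m" n] X_anti[of "Suc n" m] Z(1)[of m] Z(1)[of n] that
          by blast
      qed
      then have "\<exists>m. {n. i \<in> Z n} \<subseteq> {m}" by blast
      then show ?thesis using finite_subset by blast
    qed
    then show False using point_finite[of Z] Z(2) by blast
  qed
  then obtain X where XI: "X \<subseteq> I" and X: "\<not> null X"
    and atom: "\<And>Y. Y \<subseteq> X \<Longrightarrow> null Y \<or> null (X - Y)" by blast
  \<comment> \<open>The sets containing \<open>X\<close> up to a null set. The atom property decides
    between a set and its complement, \<open>null_UN\<close> gives countable completeness, and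
    nullity of singletons makes \<open>U\<close> non-principal.\<close>
  define U where "U = {Y. Y \<subseteq> I \<and> null (X - Y)}"
  have null_singleton: "null {x}" if "x \<in> I" for x
    using single[OF that] null_empty unfolding null_def by (auto simp: subset_singleton_iff)
  have "measurable_card I"
    unfolding measurable_card_def
  proof (intro exI[of _ U] conjI ballI allI impI)
    show "I \<in> U" using XI null_empty by (simp add: U_def Diff_eq_empty_iff[THEN iffD2])
    show "{} \<notin> U" using X by (simp add: U_def)
    show "Y' \<in> U" if "Y \<in> U" "Y \<subseteq> Y' \<and> Y' \<subseteq> I" for Y Y'
      using that null_mono[of "X - Y" "X - Y'"] unfolding U_def by blast
    show "Y \<in> U \<or> I - Y \<in> U" if "Y \<subseteq> I" for Y
    proof -
      have "X - (I - Y) = X \<inter> Y" "X - X \<inter> Y = X - Y" using XI by auto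
      then show ?thesis using atom[of "X \<inter> Y"] that unfolding U_def by auto
    qed
    show "(\<Inter>n. F n) \<in> U" if F: "\<forall>n::nat. F n \<in> U" for F
    proof -
      have "X - (\<Inter>n. F n) = (\<Union>n. X - F n)" by auto
      then show ?thesis using null_UN[of "\<lambda>n. X - F n"] F unfolding U_def by auto
    qed
    show "{x} \<notin> U" if "x \<in> I" for x
    proof
      assume "{x} \<in> U"
      then have "null ({x} \<union> (X - {x}))" using null_Un[OF null_singleton[OF that]] unfolding U_def by blast
      then show False using X null_mono by blast
    qed
  qed (auto simp: U_def)
  with nonmeas show False by blast
qed

text \<open>If infinitely many factors were not killed by \<open>f\<close>, witnesses from all of
  them could be combined into one vector, against slenderness. On the remaining factors
  \<open>slender_vanish\<close> applies.\<close>

lemma slender_finite_support: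
  fixes A :: "'i \<Rightarrow> ('r::ring_1, 'm) rmod" and M :: "('r, 'n) rmod"
  assumes A: "\<And>i. i \<in> I \<Longrightarrow> right_module (A i)" and M: "right_module M"
    and "slender M" and f: "is_rhom (rprod I A) M f"
    and nonmeas: "\<not> measurable_card I"
  obtains F where "finite F" "F \<subseteq> I"
    "\<And>x. x \<in> mcarrier (rprod I A) \<Longrightarrow> f (prod_cut I A F x) = f x"
proof -
  define F where "F = {i\<in>I. \<exists>x\<in>mcarrier (rprod I A). f (prod_cut I A {i} x) \<noteq> mzero M}"
  have ex: "\<forall>i\<in>F. \<exists>x. x \<in> mcarrier (rprod I A) \<and> f (prod_cut I A {i} x) \<noteq> mzero M"
    by (auto simp: F_def)
  obtain X where
    X: "\<And>i. i \<in> F \<Longrightarrow> X i \<in> mcarrier (rprod I A) \<and> f (prod_cut I A {i} (X i)) \<noteq> mzero M"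
    using bchoice[OF ex] by auto
  have "finite F"
  proof (rule ccontr)
    assume "infinite F"
    then obtain e :: "nat \<Rightarrow> 'i" where e: "inj e" "range e \<subseteq> F"
      using infinite_countable_subset by blast
    \<comment> \<open>The diagonal vector: coordinate \<open>i \<in> F\<close> is taken from the
      witness \<open>X i\<close> belonging to \<open>i\<close>.\<close>
    define a where "a = (\<lambda>i\<in>I. if i \<in> F then X i i else mzero (A i))"
    have a: "a \<in> mcarrier (rprod I A)"
      using rprod_mem[of "X _" I A] X A by (auto simp: a_def rprod_simps right_module_closed)
    have "finite {n. i \<in> {e n}}" for i
    proof -
      have "{n. i \<in> {e n}} = e -` {i}" by auto
      then show ?thesis using finite_vimageI[OF _ e(1), of "{i}"] by simp
    qed
    then obtain n where "f (prod_cut I A {e n} a) = mzero M"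
      using slender_point_finite[OF A \<open>slender M\<close> f a, of "\<lambda>n. {e n}"] by blast
    moreover have "prod_cut I A {e n} a = prod_cut I A {e n} (X (e n))"
      using subsetD[OF e(2) rangeI] by (auto simp: prod_cut_def a_def intro!: restrict_ext)
    ultimately show False using X[of "e n"] e by auto
  qed
  moreover have "f (prod_cut I A F x) = f x" if x: "x \<in> mcarrier (rprod I A)" for x
  proof -
    \<comment> \<open>Cutting this vector to one coordinate leaves zero when the coordinate is in
      \<open>F\<close>, and a vector killed by \<open>f\<close> otherwise, by the definition of
      \<open>F\<close>.\<close>
    have "f (prod_cut I A (I - F) x) = mzero M"
    proof (rule slender_vanish[OF A M \<open>slender M\<close> f nonmeas prod_cut_closed[OF A x]])
      show "f (prod_cut I A {i} (prod_cut I A (I - F) x)) = mzero M" if "i \<in> I" for i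
      proof (cases "i \<in> F")
        case True
        then show ?thesis
          using is_rhom_zero_neg(1)[OF right_module_rprod[OF A] M f] by (simp add: prod_cut_cut prod_cut_empty)
      next
        case False
        then show ?thesis using that x by (simp add: prod_cut_cut F_def)
      qed
    qed
    moreover have "I \<inter> F = F" by (auto simp: F_def)
    ultimately show ?thesis
      using is_rhom_prod_cut_split[OF A x f, of I F] prod_cut_all[OF x]
        madd_zero_right[OF M, of "f (prod_cut I A F x)"] is_rhomD(1)[OF f] prod_cut_closed[OF A x] by simp
  qed
  ultimately show thesis using that[of F] by (auto simp: F_def)
qed

section \<open>Completely prime ideals\<close>

locale completely_prime =
  fixes C :: "('r::ring_1, 'm) rmod set"
    and P :: "('r, 'm) rmod \<Rightarrow> ('r, 'm) rmod \<Rightarrow> ('m \<Rightarrow> 'm) set"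
  assumes modules: "M \<in> C \<Longrightarrow> right_module M"
    and prime: "completely_prime_ideal C P"
begin

text \<open>Restricting first makes membership independent of values off the carrier, so composites
  can be written as plain lambda terms.\<close>

definition inP :: "('r, 'm) rmod \<Rightarrow> ('r, 'm) rmod \<Rightarrow> ('m \<Rightarrow> 'm) \<Rightarrow> bool" where
  "inP M N f \<longleftrightarrow> restrict f (mcarrier M) \<in> P M N"

text \<open>On \<open>C\<close> this is a preorder whose symmetric part is
  \<open>same_class\<close>.\<close>

definition linked :: "('r, 'm) rmod \<Rightarrow> ('r, 'm) rmod \<Rightarrow> bool" where
  "linked M N \<longleftrightarrow> (\<exists>f. is_rhom M N f \<and> \<not> inP M N f)"

lemma P_subgroup: "M \<in> C \<Longrightarrow> N \<in> C \<Longrightarrow> hom_subgroup M N (P M N)"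
  using prime unfolding completely_prime_ideal_def by blast

lemma inP_cong: "(\<And>x. x \<in> mcarrier M \<Longrightarrow> f x = g x) \<Longrightarrow> inP M N f \<longleftrightarrow> inP M N g"
  unfolding inP_def using restrict_ext[of "mcarrier M" f g] by simp

lemma inP_eqI:
  assumes "inP M N g" "\<And>x. x \<in> mcarrier M \<Longrightarrow> f x = g x"
  shows "inP M N f"
  using assms inP_cong[of M f g N] by blast

lemma inP_is_rhom: "M \<in> C \<Longrightarrow> N \<in> C \<Longrightarrow> inP M N f \<Longrightarrow> is_rhom M N f"
  using P_subgroup[of M N] restrict_in_rhom_iff[OF modules, of M f N]
  unfolding inP_def hom_subgroup_def by blast

lemma inP_zero: "M \<in> C \<Longrightarrow> N \<in> C \<Longrightarrow> inP M N (\<lambda>_. mzero N)"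
  using P_subgroup[of M N] unfolding inP_def hom_subgroup_def hzero_def by simp

lemma inP_add:
  assumes "M \<in> C" "N \<in> C" "inP M N f" "inP M N g"
  shows "inP M N (\<lambda>x. madd N (f x) (g x))"
proof -
  have "hadd M N (restrict f (mcarrier M)) (restrict g (mcarrier M)) \<in> P M N"
    using P_subgroup[of M N] assms unfolding inP_def hom_subgroup_def by blast
  moreover have "hadd M N (restrict f (mcarrier M)) (restrict g (mcarrier M)) =
      (\<lambda>x\<in>mcarrier M. madd N (f x) (g x))"
    unfolding hadd_def by (rule restrict_ext) simp
  ultimately show ?thesis unfolding inP_def by simp
qed

lemma inP_neg:
  assumes "M \<in> C" "N \<in> C" "inP M N f"
  shows "inP M N (\<lambda>x. mneg N (f x))"
proof -
  have "hneg M N (restrict f (mcarrier M)) \<in> P M N"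
    using P_subgroup[of M N] assms unfolding inP_def hom_subgroup_def by blast
  moreover have "hneg M N (restrict f (mcarrier M)) = (\<lambda>x\<in>mcarrier M. mneg N (f x))"
    unfolding hneg_def by (rule restrict_ext) simp
  ultimately show ?thesis unfolding inP_def by simp
qed

lemma inP_comp_iff:
  assumes "M \<in> C" "N \<in> C" "K \<in> C" "is_rhom M N f" "is_rhom N K g"
  shows "inP M K (\<lambda>x. g (f x)) \<longleftrightarrow> inP M N f \<or> inP N K g"
proof -
  have "restrict f (mcarrier M) \<in> rhom M N" "restrict g (mcarrier N) \<in> rhom N K"
    using assms by (simp_all add: restrict_in_rhom_iff modules)
  then have "compose (mcarrier M) (restrict g (mcarrier N)) (restrict f (mcarrier M)) \<in> P M K
      \<longleftrightarrow> inP M N f \<or> inP N K g"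
    using prime assms(1-3) unfolding completely_prime_ideal_def inP_def by blast
  moreover have "compose (mcarrier M) (restrict g (mcarrier N)) (restrict f (mcarrier M)) =
      (\<lambda>x\<in>mcarrier M. g (f x))"
    unfolding compose_def using is_rhomD(1)[OF assms(4)] by (intro restrict_ext) simp
  ultimately show ?thesis unfolding inP_def by simp
qed

lemma linked_iff:
  assumes "M \<in> C" "N \<in> C"
  shows "linked M N \<longleftrightarrow> P M N \<noteq> rhom M N"
proof
  assume "linked M N"
  then obtain f where "is_rhom M N f" "\<not> inP M N f" unfolding linked_def by blast
  then have "restrict f (mcarrier M) \<in> rhom M N - P M N"
    using restrict_in_rhom_iff[OF modules[OF assms(1)]] unfolding inP_def by blast
  then show "P M N \<noteq> rhom M N" by blast
next
  assume "P M N \<noteq> rhom M N"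
  moreover have "P M N \<subseteq> rhom M N"
    using P_subgroup[OF assms] unfolding hom_subgroup_def by blast
  ultimately obtain f where f: "f \<in> rhom M N" "f \<notin> P M N" by blast
  then have "is_rhom M N f \<and> \<not> inP M N f"
    using rhom_is_rhom rhom_restrict[OF f(1)] unfolding inP_def by simp
  then show "linked M N" unfolding linked_def by blast
qed

lemma linked_refl: "M \<in> C \<Longrightarrow> linked M M"
  using linked_iff prime unfolding completely_prime_ideal_def by blast

text \<open>By complete primeness, composing two morphisms outside P gives a morphism outside
  P.\<close>

lemma linked_trans:
  assumes "M \<in> C" "N \<in> C" "K \<in> C" "linked M N" "linked N K"
  shows "linked M K"
  using assms inP_comp_iff[OF assms(1-3)] is_rhom_comp[of M N _ K] unfolding linked_def by meson

lemma same_class_iff: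
  assumes "M \<in> C" "N \<in> C"
  shows "same_class P M N \<longleftrightarrow> linked M N \<and> linked N M"
  using assms by (simp add: same_class_def linked_iff)

lemma same_class_refl: "M \<in> C \<Longrightarrow> same_class P M M"
  by (simp add: same_class_iff linked_refl)

lemma same_class_sym: "same_class P M N \<Longrightarrow> same_class P N M"
  by (auto simp: same_class_def)

lemma same_class_trans:
  assumes "M \<in> C" "N \<in> C" "K \<in> C" "same_class P M N" "same_class P N K"
  shows "same_class P M K"
  using assms linked_trans[of M N K] linked_trans[of K N M] by (simp add: same_class_iff)

text \<open>A cut to finitely many coordinates is the sum of the cuts to single ones, and P is
  closed under finite sums.\<close>

lemma inP_prod_cut:
  assumes A: "\<And>i. i \<in> I \<Longrightarrow> A i \<in> C" and U: "U \<in> C" and M: "M \<in> C"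
    and f: "is_rhom (rprod I A) M f" and w: "is_rhom U (rprod I A) w"
    and "finite F" and "\<And>i. i \<in> F \<Longrightarrow> inP U M (\<lambda>x. f (prod_cut I A {i} (w x)))"
  shows "inP U M (\<lambda>x. f (prod_cut I A F (w x)))"
  using assms(6,7)
proof (induction F)
  case empty
  have "f (mzero (rprod I A)) = mzero M"
    using is_rhom_zero_neg(1)[OF right_module_rprod modules[OF M] f] A modules by blast
  then show ?case using inP_zero[OF U M] by (simp add: prod_cut_empty)
next
  case (insert i F)
  have "insert i F \<inter> {i} = {i}" "insert i F - {i} = F" using insert.hyps by auto
  then have eq: "f (prod_cut I A (insert i F) (w x)) =
      madd M (f (prod_cut I A {i} (w x))) (f (prod_cut I A F (w x)))" if "x \<in> mcarrier U" for x
    using is_rhom_prod_cut_split[OF _ is_rhomD(1)[OF w that] f, of "insert i F" "{i}"] A modules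
    by simp
  have "inP U M (\<lambda>x. madd M (f (prod_cut I A {i} (w x))) (f (prod_cut I A F (w x))))"
    using insert.prems insert.IH by (intro inP_add[OF U M]) auto
  then show ?case using eq by (rule inP_eqI)
qed

text \<open>The map factors through \<open>A i\<close>: first the \<open>i\<close>-th coordinate of
  \<open>w\<close>, then \<open>f\<close> on the embedded factor. Complete primeness is applied to
  this composite.\<close>

lemma inP_prod_cut_singleton_iff:
  assumes A: "\<And>i. i \<in> I \<Longrightarrow> A i \<in> C" and U: "U \<in> C" and M: "M \<in> C" and i: "i \<in> I"
    and f: "is_rhom (rprod I A) M f" and w: "is_rhom U (rprod I A) w"
  shows "inP U M (\<lambda>x. f (prod_cut I A {i} (w x))) \<longleftrightarrow>
    inP U (A i) (\<lambda>x. w x i) \<or> inP (A i) M (\<lambda>y. f (single I A i y))"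
  unfolding prod_cut_singleton
  by (rule inP_comp_iff[OF U A[OF i] M is_rhom_comp[OF w is_rhom_proj[of i I A, OF i]]
      is_rhom_comp[OF is_rhom_single[of I A, OF modules[OF A] i] f]])

end

section \<open>Gaussian elimination modulo P\<close>

locale completely_prime_maximal = completely_prime +
  assumes maximal: "M \<in> C \<Longrightarrow> end_maximal_right_ideal M (P M M)"
begin

text \<open>The set \<open>Q\<close> below is the right ideal generated by \<open>P M M\<close> and
  \<open>k\<close>. It strictly contains \<open>P M M\<close>, so by maximality it contains the
  identity. The sum in place of a difference makes \<open>s\<close> the negative of a right inverse
  of \<open>k\<close> modulo P.\<close>

lemma right_inverse_mod_P:
  assumes M: "M \<in> C" and k: "is_rhom M M k" and "\<not> inP M M k"
  obtains s where "is_rhom M M s" "inP M M (\<lambda>x. madd M x (k (s x)))"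
proof -
  note mod = modules[OF M]
  note closed = right_module_closed[OF mod]
  note kD = is_rhomD[OF k]
  define Q where "Q = {g \<in> rhom M M. \<exists>s. is_rhom M M s \<and> inP M M (\<lambda>x. madd M (g x) (k (s x)))}"
  have memQ: "restrict g (mcarrier M) \<in> Q"
    if "is_rhom M M g" "is_rhom M M s" "inP M M (\<lambda>x. madd M (g x) (k (s x)))" for g s
  proof -
    have "inP M M (\<lambda>x. madd M (restrict g (mcarrier M) x) (k (s x)))"
      by (rule inP_eqI[OF that(3)]) simp
    then show ?thesis
      using that(1,2) restrict_in_rhom_iff[OF mod] unfolding Q_def by blast
  qed
  have k0: "k (mzero M) = mzero M" and kneg: "\<And>x. x \<in> mcarrier M \<Longrightarrow> k (mneg M x) = mneg M (k x)"
    using is_rhom_zero_neg[OF mod mod k] by auto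
  have PQ: "g \<in> Q" if "g \<in> P M M" for g
  proof -
    have g: "g \<in> rhom M M" using that P_subgroup[OF M M] unfolding hom_subgroup_def by blast
    then have "inP M M g" using that rhom_restrict unfolding inP_def by metis
    \<comment> \<open>Elements of P belong to \<open>Q\<close> with the zero map as
      \<open>s\<close>.\<close>
    then have "inP M M (\<lambda>x. madd M (g x) (k (mzero M)))"
      by (rule inP_eqI) (simp add: k0 madd_zero_right[OF mod] is_rhomD(1)[OF rhom_is_rhom[OF g]])
    then show ?thesis
      using memQ[OF rhom_is_rhom[OF g] is_rhom_zero[OF mod]] rhom_restrict[OF g] by simp
  qed
  have "end_right_ideal M Q"
    unfolding end_right_ideal_def hom_subgroup_def
  proof (intro conjI ballI)
    show "Q \<subseteq> rhom M M" unfolding Q_def by blast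
    show "hzero M M \<in> Q"
      using PQ P_subgroup[OF M M] unfolding hom_subgroup_def by blast
    fix g assume "g \<in> Q"
    then obtain s where g: "is_rhom M M g" and s: "is_rhom M M s"
      and gs: "inP M M (\<lambda>x. madd M (g x) (k (s x)))"
      unfolding Q_def using rhom_is_rhom by blast
    note gD = is_rhomD[OF g] and sD = is_rhomD[OF s]
    show "hneg M M g \<in> Q"
      unfolding hneg_def
    proof (rule memQ[OF is_rhom_neg[OF mod g] is_rhom_neg[OF mod s]])
      have "madd M (mneg M (g x)) (k (mneg M (s x))) = mneg M (madd M (g x) (k (s x)))"
        if "x \<in> mcarrier M" for x
        using that by (simp add: kneg mneg_add[OF mod] gD(1) sD(1) kD(1))
      then show "inP M M (\<lambda>x. madd M (mneg M (g x)) (k (mneg M (s x))))"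
        by (rule inP_eqI[OF inP_neg[OF M M gs]])
    qed
    show "hadd M M g g' \<in> Q" if "g' \<in> Q" for g'
    proof -
      obtain s' where g': "is_rhom M M g'" and s': "is_rhom M M s'"
        and gs': "inP M M (\<lambda>x. madd M (g' x) (k (s' x)))"
        using \<open>g' \<in> Q\<close> unfolding Q_def using rhom_is_rhom by blast
      note g'D = is_rhomD[OF g'] and s'D = is_rhomD[OF s']
      show ?thesis
        unfolding hadd_def
      proof (rule memQ[OF is_rhom_add[OF mod g g'] is_rhom_add[OF mod s s']])
        have "madd M (madd M (g x) (g' x)) (k (madd M (s x) (s' x))) =
            madd M (madd M (g x) (k (s x))) (madd M (g' x) (k (s' x)))" if "x \<in> mcarrier M" for x
          using that by (simp add: kD gD(1) sD(1) g'D(1) s'D(1) right_module_add(1)[OF mod] closed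
              madd_left_commute[OF mod, of "g' x" "k (s x)" "k (s' x)"])
        then show "inP M M (\<lambda>x. madd M (madd M (g x) (g' x)) (k (madd M (s x) (s' x))))"
          by (rule inP_eqI[OF inP_add[OF M M gs gs']])
      qed
    qed
    show "compose (mcarrier M) g h \<in> Q" if "h \<in> rhom M M" for h
    proof -
      note h = rhom_is_rhom[OF that]
      show ?thesis
        unfolding compose_def
      proof (rule memQ[OF is_rhom_comp[OF h g] is_rhom_comp[OF h s]])
        \<comment> \<open>This is the morphism \<open>g + k s\<close> of P precomposed with
          \<open>h\<close>, and P absorbs composition by complete primeness.\<close>
        show "inP M M (\<lambda>x. madd M (g (h x)) (k (s (h x))))"
          using inP_comp_iff[OF M M M h is_rhom_add[OF mod g is_rhom_comp[OF s k]]] gs by blast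
      qed
    qed
  qed
  moreover have "restrict k (mcarrier M) \<in> Q"
  proof (rule memQ[OF k is_rhom_neg[OF mod is_rhom_id]])
    have "madd M (k x) (k (mneg M x)) = mzero M" if "x \<in> mcarrier M" for x
      using that by (simp add: kneg kD(1) madd_neg_right[OF mod])
    then show "inP M M (\<lambda>x. madd M (k x) (k (mneg M x)))"
      by (rule inP_eqI[OF inP_zero[OF M M]])
  qed
  then have "Q \<noteq> P M M" using \<open>\<not> inP M M k\<close> unfolding inP_def by blast
  ultimately have "Q = rhom M M"
    using maximal[OF M] PQ unfolding end_maximal_right_ideal_def by blast
  then have "restrict (\<lambda>x. x) (mcarrier M) \<in> Q"
    using restrict_in_rhom_iff[OF mod] is_rhom_id by blast
  then obtain s where s: "is_rhom M M s"
    and Ps: "inP M M (\<lambda>x. madd M (restrict (\<lambda>x. x) (mcarrier M) x) (k (s x)))"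
    unfolding Q_def by blast
  have "inP M M (\<lambda>x. madd M x (k (s x)))" by (rule inP_eqI[OF Ps]) simp
  with s show thesis using that by blast
qed

text \<open>A homogeneous system with more unknowns than equations has a nontrivial solution
  modulo P. Elimination uses the pivot \<open>v j\<close> restricted to the factor \<open>A i\<^sub>0\<close>: the endomorphism T
  of the product turns the pivot equation into one that holds modulo P for every argument.\<close>
lemma linear_system_mod_P:
  assumes A: "\<And>i. i \<in> I \<Longrightarrow> A i \<in> C" and U: "U \<in> C"
    and "finite G" and "finite F" and "F \<subseteq> I" and "card G < card F"
    and "\<And>j. j \<in> G \<Longrightarrow> B j \<in> C" and "\<And>j. j \<in> G \<Longrightarrow> is_rhom (rprod I A) (B j) (v j)"
    and "\<And>i. i \<in> F \<Longrightarrow> linked U (A i)" and "\<And>i j. i \<in> F \<Longrightarrow> j \<in> G \<Longrightarrow> linked (B j) (A i)"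
  shows "\<exists>w. is_rhom U (rprod I A) w \<and> (\<forall>x\<in>mcarrier U. prod_cut I A F (w x) = w x) \<and>
    (\<forall>j\<in>G. inP U (B j) (\<lambda>x. v j (w x))) \<and> (\<exists>i\<in>F. \<not> inP U (A i) (\<lambda>x. w x i))"
  using assms(3-)
proof (induction G arbitrary: F v)
  case empty
  \<comment> \<open>With no equations left, any morphism from \<open>U\<close> outside P, placed in
    a single factor, is a solution.\<close>
  then obtain i where i: "i \<in> F" "i \<in> I" by (metis card.empty card_gt_0_iff ex_in_conv subsetD)
  obtain u where u: "is_rhom U (A i) u" "\<not> inP U (A i) u"
    using empty(6)[OF i(1)] unfolding linked_def by blast
  have "is_rhom U (rprod I A) (\<lambda>x. single I A i (u x))"
    by (rule is_rhom_comp[OF u(1) is_rhom_single[of I A, OF modules[OF A] i(2)]])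
  moreover have "prod_cut I A F (single I A i y) = single I A i y" for y
    using i by (auto simp: prod_cut_def single_def)
  moreover have "single I A i y i = y" for y
    using i by (simp add: single_def)
  ultimately show ?case
    using u(2) by (intro exI[of _ "\<lambda>x. single I A i (u x)"] conjI bexI[OF _ i(1)]) auto
next
  case (insert j G)
  note mA = modules[OF A]
  note prodm = right_module_rprod[of I A, OF mA]
  have Bj: "B j \<in> C" and vj: "is_rhom (rprod I A) (B j) (v j)" using insert.prems by auto
  show ?case
  proof (cases "\<forall>i\<in>F. inP (A i) (B j) (\<lambda>y. v j (single I A i y))")
    case True
    have "card G < card F" using insert.prems(3) insert.hyps by simp
    then obtain w where w: "is_rhom U (rprod I A) w"
      and cut: "\<forall>x\<in>mcarrier U. prod_cut I A F (w x) = w x"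
      and G: "\<forall>j\<in>G. inP U (B j) (\<lambda>x. v j (w x))" and ex: "\<exists>i\<in>F. \<not> inP U (A i) (\<lambda>x. w x i)"
      using insert.IH[of F v] insert.prems by auto
    have cutP: "inP U (B j) (\<lambda>x. v j (prod_cut I A F (w x)))"
      using inP_prod_cut[OF A U Bj vj w] inP_prod_cut_singleton_iff[OF A U Bj _ vj w]
        True insert.prems(1,2) by blast
    have "inP U (B j) (\<lambda>x. v j (w x))" by (rule inP_eqI[OF cutP]) (simp add: cut)
    then show ?thesis using w cut G ex by blast
  next
    case False
    then obtain i0 where i0: "i0 \<in> F" "i0 \<in> I" and pivot: "\<not> inP (A i0) (B j) (\<lambda>y. v j (single I A i0 y))"
      using insert.prems(2) by blast
    have sing: "is_rhom (A i0) (rprod I A) (single I A i0)"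
      by (rule is_rhom_single[of I A, OF mA i0(2)])
    \<comment> \<open>The pivot goes from \<open>A i0\<close> to \<open>B j\<close>. Precomposing it
      with \<open>h\<close> yields an endomorphism of \<open>B j\<close> outside P, which
      \<open>right_inverse_mod_P\<close> can invert modulo P.\<close>
    obtain h where h: "is_rhom (B j) (A i0) h" "\<not> inP (B j) (A i0) h"
      using insert.prems(7)[OF i0(1)] unfolding linked_def by blast
    have vs: "is_rhom (A i0) (B j) (\<lambda>y. v j (single I A i0 y))"
      by (rule is_rhom_comp[OF sing vj])
    obtain s where s: "is_rhom (B j) (B j) s"
      and Ps: "inP (B j) (B j) (\<lambda>y. madd (B j) y (v j (single I A i0 (h (s y)))))"
    proof (rule right_inverse_mod_P[OF Bj is_rhom_comp[OF h(1) vs]])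
      show "\<not> inP (B j) (B j) (\<lambda>y. v j (single I A i0 (h y)))"
        using inP_comp_iff[OF Bj A[OF i0(2)] Bj h(1) vs] h(2) pivot by blast
    qed
    \<comment> \<open>\<open>T\<close> corrects only coordinate \<open>i0\<close>. With
      \<open>p\<close> the pivot, \<open>v j\<close> after \<open>T\<close> equals
      \<open>1 + p h s\<close> after \<open>v j\<close>, and \<open>1 + p h s\<close> lies in P by
      the choice of \<open>s\<close>.\<close>
    define T where "T = (\<lambda>y. madd (rprod I A) y (single I A i0 (h (s (v j y)))))"
    have hs: "is_rhom (rprod I A) (rprod I A) (\<lambda>y. single I A i0 (h (s (v j y))))"
      by (intro is_rhom_comp[OF _ sing] is_rhom_comp[OF _ h(1)] is_rhom_comp[OF vj s])
    have T: "is_rhom (rprod I A) (rprod I A) T"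
      unfolding T_def by (rule is_rhom_add[OF prodm is_rhom_id hs])
    have T_other: "T y i = y i" if "y \<in> mcarrier (rprod I A)" "i \<in> I" "i \<noteq> i0" for y i
      using that rprod_mem[OF that(1,2)] mA[OF that(2)]
      by (simp add: T_def rprod_simps single_def madd_zero_right)
    have vT: "v j (T y) = madd (B j) (v j y) (v j (single I A i0 (h (s (v j y)))))"
      if "y \<in> mcarrier (rprod I A)" for y
      unfolding T_def using is_rhomD(2)[OF vj that is_rhomD(1)[OF hs that]] by simp
    have vT_hom: "is_rhom (rprod I A) (B k) (\<lambda>y. v k (T y))" if "k \<in> G" for k
      using is_rhom_comp[OF T] insert.prems(5) that by blast
    \<comment> \<open>One unknown and one equation are eliminated: the remaining equations are
      precomposed with \<open>T\<close>, and a solution \<open>w\<close> of theirs yields the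
      solution \<open>T\<close> after \<open>w\<close>.\<close>
    have "F - {i0} \<subseteq> I" using insert.prems(2) by blast
    moreover have "card G < card (F - {i0})"
      using insert.prems(1,3) insert.hyps i0(1) by (simp add: card_Diff_singleton)
    ultimately obtain w where w: "is_rhom U (rprod I A) w"
      and cut: "\<forall>x\<in>mcarrier U. prod_cut I A (F - {i0}) (w x) = w x"
      and G: "\<forall>k\<in>G. inP U (B k) (\<lambda>x. v k (T (w x)))"
      and ex: "\<exists>i\<in>F - {i0}. \<not> inP U (A i) (\<lambda>x. w x i)"
      using insert.IH[of "F - {i0}" "\<lambda>k y. v k (T y)"] insert.prems(1,4,6,7) vT_hom by auto
    have Tw: "is_rhom U (rprod I A) (\<lambda>x. T (w x))" by (rule is_rhom_comp[OF w T])
    show ?thesis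
    proof (intro exI[of _ "\<lambda>x. T (w x)"] conjI ballI)
      show "is_rhom U (rprod I A) (\<lambda>x. T (w x))" by fact
      fix x assume x: "x \<in> mcarrier U"
      have wx: "w x \<in> mcarrier (rprod I A)" by (rule is_rhomD(1)[OF w x])
      show "prod_cut I A F (T (w x)) = T (w x)"
      proof (rule rprod_eqI[OF prod_cut_closed[OF mA] is_rhomD(1)[OF Tw x]])
        show "T (w x) \<in> mcarrier (rprod I A)" by (rule is_rhomD(1)[OF Tw x])
        show "prod_cut I A F (T (w x)) i = T (w x) i" if "i \<in> I" for i
        proof (cases "i \<in> F")
          case False
          then have "w x i = mzero (A i)" "i \<noteq> i0"
            using fun_cong[OF bspec[OF cut x], of i] that i0 by (auto simp: prod_cut_def)
          then show ?thesis using False that T_other[OF wx that] by (simp add: prod_cut_def)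
        qed (simp add: prod_cut_def that)
      qed
    next
      fix k assume "k \<in> insert j G"
      then consider "k \<in> G" | "k = j" by blast
      then show "inP U (B k) (\<lambda>x. v k (T (w x)))"
      proof cases
        case 2
        have sumP: "inP U (B j) (\<lambda>x. madd (B j) (v j (w x)) (v j (single I A i0 (h (s (v j (w x)))))))"
          using inP_comp_iff[OF U Bj Bj is_rhom_comp[OF w vj] inP_is_rhom[OF Bj Bj Ps]] Ps by blast
        show ?thesis
          unfolding 2 by (rule inP_eqI[OF sumP vT[OF is_rhomD(1)[OF w]]])
      qed (use G in blast)
    next
      obtain i where i: "i \<in> F" "i \<noteq> i0" "i \<in> I" and nP: "\<not> inP U (A i) (\<lambda>x. w x i)"
        using ex insert.prems(2) by blast
      \<comment> \<open>Nontriviality survives because the nontrivial coordinate differs from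
        \<open>i0\<close> and is untouched by \<open>T\<close>.\<close>
      have "inP U (A i) (\<lambda>x. T (w x) i) \<longleftrightarrow> inP U (A i) (\<lambda>x. w x i)"
        by (rule inP_cong) (rule T_other[OF is_rhomD(1)[OF w] i(3,2)])
      then show "\<exists>i\<in>F. \<not> inP U (A i) (\<lambda>x. T (w x) i)" using i(1) nP by blast
    qed
  qed
qed

text \<open>Otherwise some \<open>w\<close> supported on \<open>F\<close>, nontrivial modulo P, has
  all coordinates of \<open>\<alpha> w\<close> in the class of \<open>U\<close> lying in P.
  Recovering \<open>w\<close> by \<open>\<beta>\<close> then puts every coordinate of
  \<open>w\<close> in P.\<close>

lemma card_class_le:
  assumes A: "\<And>i. i \<in> I \<Longrightarrow> A i \<in> C" and B: "\<And>j. j \<in> J \<Longrightarrow> B j \<in> C" and U: "U \<in> C"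
    and slender: "\<And>M. M \<in> C \<Longrightarrow> slender M" and nonmeas: "\<not> measurable_card J"
    and \<alpha>: "is_rhom (rprod I A) (rprod J B) \<alpha>" and \<beta>: "is_rhom (rprod J B) (rprod I A) \<beta>"
    and inv: "\<And>x. x \<in> mcarrier (rprod I A) \<Longrightarrow> \<beta> (\<alpha> x) = x"
    and F: "finite F" "F \<subseteq> {i\<in>I. same_class P (A i) U}"
    and fin: "finite {j\<in>J. same_class P (B j) U}"
  shows "card F \<le> card {j\<in>J. same_class P (B j) U}"
proof (rule ccontr)
  define G where "G = {j\<in>J. same_class P (B j) U}"
  assume "\<not> ?thesis"
  then have card: "card G < card F" by (simp add: G_def)
  have FI: "F \<subseteq> I" using F by blast
  have linkF: "linked U (A i)" "linked (A i) U" if "i \<in> F" for i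
    using that F same_class_iff[OF A U] by auto
  have linkG: "linked (B j) (A i)" if "i \<in> F" "j \<in> G" for i j
    using that linked_trans[OF B U A] linkF same_class_iff[OF B U] FI unfolding G_def by blast
  have v: "is_rhom (rprod I A) (B j) (\<lambda>x. \<alpha> x j)" if "j \<in> J" for j
    by (rule is_rhom_comp[OF \<alpha> is_rhom_proj[of j J B, OF that]])
  have "\<exists>w. is_rhom U (rprod I A) w \<and> (\<forall>x\<in>mcarrier U. prod_cut I A F (w x) = w x) \<and>
      (\<forall>j\<in>G. inP U (B j) (\<lambda>x. \<alpha> (w x) j)) \<and> (\<exists>i\<in>F. \<not> inP U (A i) (\<lambda>x. w x i))"
  proof (rule linear_system_mod_P[OF A U _ F(1) FI card, where v = "\<lambda>j x. \<alpha> x j"])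
    show "finite G" using fin by (simp add: G_def)
  qed (use B v linkF linkG in \<open>auto simp: G_def\<close>)
  then obtain w i where w: "is_rhom U (rprod I A) w" and G: "\<forall>j\<in>G. inP U (B j) (\<lambda>x. \<alpha> (w x) j)"
    and i: "i \<in> F" "i \<in> I" and nP: "\<not> inP U (A i) (\<lambda>x. w x i)"
    using FI by blast
  have \<alpha>w: "is_rhom U (rprod J B) (\<lambda>x. \<alpha> (w x))" by (rule is_rhom_comp[OF w \<alpha>])
  have \<beta>i: "is_rhom (rprod J B) (A i) (\<lambda>y. \<beta> y i)"
    by (rule is_rhom_comp[OF \<beta> is_rhom_proj[of i I A, OF i(2)]])
  \<comment> \<open>Slenderness turns the passage through the whole product into a finite sum, to
    which closure of P under addition applies.\<close>
  obtain H where H: "finite H" "H \<subseteq> J"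
    and supp: "\<And>y. y \<in> mcarrier (rprod J B) \<Longrightarrow> \<beta> (prod_cut J B H y) i = \<beta> y i"
    using slender_finite_support[OF modules[OF B] modules[OF A[OF i(2)]] slender[OF A[OF i(2)]] \<beta>i nonmeas]
    by blast
  have "inP U (A i) (\<lambda>x. \<beta> (prod_cut J B H (\<alpha> (w x))) i)"
  proof (rule inP_prod_cut[OF B U A[OF i(2)] \<beta>i \<alpha>w H(1)])
    fix j assume "j \<in> H"
    then have j: "j \<in> J" using H by blast
    \<comment> \<open>If \<open>B j\<close> is linked from \<open>U\<close> and to
      \<open>A i\<close>, it is in the class of \<open>U\<close> and equation \<open>j\<close>
      applies. Otherwise one of the two Hom groups lies entirely in P.\<close>
    have "inP U (B j) (\<lambda>x. \<alpha> (w x) j) \<or> inP (B j) (A i) (\<lambda>y. \<beta> (single J B j y) i)"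
    proof (cases "linked U (B j) \<and> linked (B j) (A i)")
      case True
      then have "j \<in> G"
        using linked_trans[OF B[OF j] A[OF i(2)] U] linkF[OF i(1)] same_class_iff[OF B[OF j] U] j
        unfolding G_def by blast
      then show ?thesis using G by blast
    next
      case False
      moreover have "is_rhom (B j) (A i) (\<lambda>y. \<beta> (single J B j y) i)"
        by (rule is_rhom_comp[OF is_rhom_single[of J B, OF modules[OF B] j] \<beta>i])
      moreover have "is_rhom U (B j) (\<lambda>x. \<alpha> (w x) j)"
        by (rule is_rhom_comp[OF \<alpha>w is_rhom_proj[of j J B, OF j]])
      ultimately show ?thesis unfolding linked_def by blast
    qed
    then show "inP U (A i) (\<lambda>x. \<beta> (prod_cut J B {j} (\<alpha> (w x))) i)"
      using inP_prod_cut_singleton_iff[OF B U A[OF i(2)] j \<beta>i \<alpha>w] by blast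
  qed
  moreover have "w x i = \<beta> (prod_cut J B H (\<alpha> (w x))) i" if "x \<in> mcarrier U" for x
    using supp[OF is_rhomD(1)[OF \<alpha>w that]] inv[OF is_rhomD(1)[OF w that]] by simp
  ultimately have "inP U (A i) (\<lambda>x. w x i)" by (rule inP_eqI)
  with nP show False by blast
qed

end

section \<open>Gluing bijections between classes\<close>

text \<open>An infinite set has finite subsets of every size, so the bounds force both sets to be
  finite or both infinite. The bounds assume finiteness of the other set because \<open>card\<close>
  is 0 on infinite sets.\<close>

lemma countable_bij_betw_if_finite_card_le:
  assumes "countable X" "countable Y"
    and XY: "\<And>F. finite F \<Longrightarrow> F \<subseteq> X \<Longrightarrow> finite Y \<Longrightarrow> card F \<le> card Y"
    and YX: "\<And>F. finite F \<Longrightarrow> F \<subseteq> Y \<Longrightarrow> finite X \<Longrightarrow> card F \<le> card X"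
  shows "\<exists>f. bij_betw f X Y"
proof -
  have "finite X" if "finite Y"
  proof (rule ccontr)
    assume "infinite X"
    then obtain F where "F \<subseteq> X" "finite F" "card F = Suc (card Y)"
      using infinite_arbitrarily_large by blast
    then show False using XY[of F] that by simp
  qed
  moreover have "finite Y" if "finite X"
  proof (rule ccontr)
    assume "infinite Y"
    then obtain F where "F \<subseteq> Y" "finite F" "card F = Suc (card X)"
      using infinite_arbitrarily_large by blast
    then show False using YX[of F] that by simp
  qed
  ultimately consider "finite X" "finite Y" | "infinite X" "infinite Y" by blast
  then show ?thesis
  proof cases
    case 1
    then have "card X = card Y" using XY[of X] YX[of Y] by (simp add: le_antisym)
    with 1 show ?thesis by (rule finite_same_card_bij)
  next
    case 2
    then show ?thesis
      using bij_betw_trans[OF to_nat_on_infinite[OF assms(1)] bij_betw_from_nat_into[OF assms(2)]]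
      by blast
  qed
qed

theorem theorem5p5:
  fixes C :: "('r::ring_1, 'm) rmod set"
    and P :: "('r, 'm) rmod \<Rightarrow> ('r, 'm) rmod \<Rightarrow> ('m \<Rightarrow> 'm) set"
    and I :: "'i set" and A :: "'i \<Rightarrow> ('r, 'm) rmod"
    and J :: "'j set" and B :: "'j \<Rightarrow> ('r, 'm) rmod"
  assumes modules: "\<forall>M\<in>C. right_module M"
    and slender: "\<forall>M\<in>C. slender M"
    and prime: "completely_prime_ideal C P"
    and A_in: "\<forall>i\<in>I. A i \<in> C"
    and B_in: "\<forall>j\<in>J. B j \<in> C"
    and I_nonmeas: "\<not> measurable_card I"
    and J_nonmeas: "\<not> measurable_card J"
    and max_ideal: "\<forall>M\<in>C. end_maximal_right_ideal M (P M M)"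
    and count_A: "\<forall>i\<in>I. countable {i'\<in>I. same_class P (A i') (A i)}"
    and count_B: "\<forall>j\<in>J. countable {j'\<in>J. same_class P (B j') (B j)}"
    and iso: "rmod_iso (rprod I A) (rprod J B)"
  shows "\<exists>\<sigma>. bij_betw \<sigma> I J \<and> (\<forall>i\<in>I. same_class P (A i) (B (\<sigma> i)))"
proof -
  interpret completely_prime_maximal C P
    using modules prime max_ideal by unfold_locales auto
  have A: "A i \<in> C" if "i \<in> I" for i using A_in that by blast
  have B: "B j \<in> C" if "j \<in> J" for j using B_in that by blast
  have sl: "slender M" if "M \<in> C" for M using slender that by blast
  obtain \<alpha> where \<alpha>: "is_rhom (rprod I A) (rprod J B) \<alpha>"
    and bij: "bij_betw \<alpha> (mcarrier (rprod I A)) (mcarrier (rprod J B))"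
    using iso rhom_is_rhom unfolding rmod_iso_def by blast
  define \<beta> where "\<beta> = inv_into (mcarrier (rprod I A)) \<alpha>"
  have \<beta>\<alpha>: "\<beta> (\<alpha> x) = x" if "x \<in> mcarrier (rprod I A)" for x
    unfolding \<beta>_def using bij that by (rule bij_betw_inv_into_left)
  have \<alpha>\<beta>: "\<alpha> (\<beta> y) = y" and \<beta>_mem: "\<beta> y \<in> mcarrier (rprod I A)"
    if "y \<in> mcarrier (rprod J B)" for y
    unfolding \<beta>_def using bij that by (auto simp: bij_betw_def f_inv_into_f inv_into_into)
  have mI: "right_module (rprod I A)" by (rule right_module_rprod) (simp add: A modules)
  have \<beta>: "is_rhom (rprod J B) (rprod I A) \<beta>"
  proof (rule is_rhomI)
    show "\<beta> (madd (rprod J B) x y) = madd (rprod I A) (\<beta> x) (\<beta> y)"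
      if "x \<in> mcarrier (rprod J B)" "y \<in> mcarrier (rprod J B)" for x y
      using is_rhomD(2)[OF \<alpha> \<beta>_mem[OF that(1)] \<beta>_mem[OF that(2)]] \<alpha>\<beta>[OF that(1)] \<alpha>\<beta>[OF that(2)]
        \<beta>\<alpha>[OF right_module_closed(2)[OF mI \<beta>_mem[OF that(1)] \<beta>_mem[OF that(2)]]] by simp
    show "\<beta> (msmult (rprod J B) x r) = msmult (rprod I A) (\<beta> x) r"
      if "x \<in> mcarrier (rprod J B)" for x r
      using is_rhomD(3)[OF \<alpha> \<beta>_mem[OF that]] \<alpha>\<beta>[OF that]
        \<beta>\<alpha>[OF right_module_closed(4)[OF mI \<beta>_mem[OF that]]] by metis
  qed (rule \<beta>_mem)
  \<comment> \<open>The members of each family in the class of \<open>U\<close>; these are the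
    blocks to be matched.\<close>
  define K where "K = (\<lambda>U. {i\<in>I. same_class P (A i) U})"
  define L where "L = (\<lambda>U. {j\<in>J. same_class P (B j) U})"
  have ex_bij: "\<exists>f. bij_betw f (K U) (L U)" if U: "U \<in> C" for U
  proof (rule countable_bij_betw_if_finite_card_le)
    \<comment> \<open>Countability is assumed for classes of members of the family, whereas
      \<open>U\<close> is an arbitrary object. If \<open>K U\<close> is nonempty, it lies in the
      class of any of its members.\<close>
    show "countable (K U)"
    proof (cases "K U = {}")
      case False
      then obtain i where i: "i \<in> I" "same_class P (A i) U" unfolding K_def by blast
      then have "K U \<subseteq> {i'\<in>I. same_class P (A i') (A i)}"
        using same_class_trans[OF A U A[OF i(1)]] same_class_sym unfolding K_def by blast
      then show ?thesis using count_A i(1) countable_subset by blast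
    qed simp
    show "countable (L U)"
    proof (cases "L U = {}")
      case False
      then obtain j where j: "j \<in> J" "same_class P (B j) U" unfolding L_def by blast
      then have "L U \<subseteq> {j'\<in>J. same_class P (B j') (B j)}"
        using same_class_trans[OF B U B[OF j(1)]] same_class_sym unfolding L_def by blast
      then show ?thesis using count_B j(1) countable_subset by blast
    qed simp
    show "card F \<le> card (L U)" if "finite F" "F \<subseteq> K U" "finite (L U)" for F
      using card_class_le[OF A B U sl J_nonmeas \<alpha> \<beta> \<beta>\<alpha> that(1)] that unfolding K_def L_def by blast
    show "card F \<le> card (K U)" if "finite F" "F \<subseteq> L U" "finite (K U)" for F
      using card_class_le[OF B A U sl I_nonmeas \<beta> \<alpha> \<alpha>\<beta> that(1)] that unfolding K_def L_def by blast
  qed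
  \<comment> \<open>Objects of the same class give literally equal index sets.\<close>
  have K_eq: "K U = K V" and L_eq: "L U = L V" if "same_class P U V" "U \<in> C" "V \<in> C" for U V
    using that same_class_trans[OF A] same_class_trans[OF B] same_class_sym
    unfolding K_def L_def by blast+
  \<comment> \<open>The bijection is chosen as a function of the pair of index sets, so that it only depends
    on the class.\<close>
  define g where "g = (\<lambda>X Y. SOME f :: 'i \<Rightarrow> 'j. bij_betw f X Y)"
  have g: "bij_betw (g (K U) (L U)) (K U) (L U)" if "U \<in> C" for U
    unfolding g_def using ex_bij[OF that] by (rule someI_ex)
  define \<sigma> where "\<sigma> = (\<lambda>i. g (K (A i)) (L (A i)) i)"
  have \<sigma>_eq: "\<sigma> i = g (K U) (L U) i" if "U \<in> C" "i \<in> K U" for U i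
  proof -
    have "same_class P (A i) U" "A i \<in> C" using that A unfolding K_def by auto
    then show ?thesis unfolding \<sigma>_def using K_eq L_eq that(1) by simp
  qed
  have self: "i \<in> K (A i)" if "i \<in> I" for i
    using that same_class_refl[OF A] unfolding K_def by blast
  have \<sigma>: "\<sigma> i \<in> J \<and> same_class P (A i) (B (\<sigma> i))" if "i \<in> I" for i
  proof -
    have "\<sigma> i \<in> L (A i)"
      unfolding \<sigma>_def using bij_betwE[OF g[OF A[OF that]]] self[OF that] by blast
    then show ?thesis using same_class_sym unfolding L_def by blast
  qed
  \<comment> \<open>Equal values put \<open>A i\<close> and \<open>A i'\<close> in one class, where
    both values come from the same injective map.\<close>
  have "inj_on \<sigma> I"
  proof (rule inj_onI)
    fix i i' assume i: "i \<in> I" "i' \<in> I" and eq: "\<sigma> i = \<sigma> i'"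
    have "same_class P (A i) (A i')"
      using same_class_trans[OF A[OF i(1)] B[of "\<sigma> i"] A[OF i(2)]] \<sigma>[OF i(1)] \<sigma>[OF i(2)] eq
        same_class_sym by metis
    then have mem: "i \<in> K (A i')" using i(1) unfolding K_def by blast
    have "g (K (A i')) (L (A i')) i = g (K (A i')) (L (A i')) i'"
      using \<sigma>_eq[OF A[OF i(2)] mem] \<sigma>_eq[OF A[OF i(2)] self[OF i(2)]] eq by simp
    then show "i = i'"
      using bij_betw_imp_inj_on[OF g[OF A[OF i(2)]]] mem self[OF i(2)] by (auto dest: inj_onD)
  qed
  moreover have "J \<subseteq> \<sigma> ` I"
  proof
    fix j assume j: "j \<in> J"
    \<comment> \<open>A preimage is found by the block bijection for the class of
      \<open>B j\<close>, which agrees with \<open>\<sigma>\<close> on that block.\<close>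
    then have "j \<in> L (B j)" using same_class_refl[OF B] unfolding L_def by blast
    then obtain i where i: "i \<in> K (B j)" "j = g (K (B j)) (L (B j)) i"
      using bij_betw_imp_surj_on[OF g[OF B[OF j]]] by blast
    then have "j = \<sigma> i" using \<sigma>_eq[OF B[OF j] i(1)] by simp
    moreover have "i \<in> I" using i(1) by (simp add: K_def)
    ultimately show "j \<in> \<sigma> ` I" by blast
  qed
  ultimately have "bij_betw \<sigma> I J" using \<sigma> unfolding bij_betw_def by blast
  then show ?thesis using \<sigma> by blast
qed

end
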